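(* If the edge-probability $p=p(n)$ satisfies $p=n^{-2/5+\varepsilon}$ (where $\varepsilon=\varepsilon(n)$) with $2n^{-2/5}\le p\le n^{-1/9}$, then with high probability $$\chi_c(G_{n,p})\le\bigl(\tfrac52+o(1)\bigr)\varepsilon\log(n)/p.$$
   Context: $G_{n,p}$ is the binomial random graph on vertex set $\{1,\dots,n\}$, in which each pair of vertices is an edge independently with probability $p=p(n)\in(0,1)$. The clique chromatic number $\chi_c(G)$ of a graph $G$ is the smallest number of colors in a vertex coloring of $G$ so that no inclusion-maximal clique is monochromatic, where isolated vertices are ignored (i.e., only inclusion-maximal cliques with at least two vertices matter). All asymptotics are as $n\to\infty$; $\log$ is the natural logarithm; $o(1)$ denotes a deterministic function of $n$ tending to $0$. "With high probability" means with probability tending to $1$ as $n\to\infty$. *)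

theory Defs
  imports "HOL-Probability.Probability" "HOL-Library.Ramsey"
begin

text \<open>
  A graph on a vertex set \<open>V\<close> is given by its edge set \<open>E \<subseteq> [V]\<^bsup>2\<^esup>\<close>; all graphs below are finite.
\<close>

definition clique :: "'a set \<Rightarrow> 'a set set \<Rightarrow> 'a set \<Rightarrow> bool" where
  "clique V E K \<longleftrightarrow> K \<subseteq> V \<and> [K]\<^bsup>2\<^esup> \<subseteq> E"

definition maximal_clique :: "'a set \<Rightarrow> 'a set set \<Rightarrow> 'a set \<Rightarrow> bool" where
  "maximal_clique V E K \<longleftrightarrow> clique V E K \<and> (\<forall>K'. clique V E K' \<and> K \<subseteq> K' \<longrightarrow> K' = K)"

text \<open>
  Isolated vertices are ignored through the restriction \<open>card K \<ge> 2\<close>: a maximal clique with a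
  single element is precisely an isolated vertex.
\<close>

definition clique_coloring :: "'a set \<Rightarrow> 'a set set \<Rightarrow> nat \<Rightarrow> ('a \<Rightarrow> nat) \<Rightarrow> bool" where
  "clique_coloring V E k c \<longleftrightarrow>
     c ` V \<subseteq> {..<k} \<and>
     (\<forall>K. maximal_clique V E K \<and> card K \<ge> 2 \<longrightarrow> \<not> (\<exists>a. \<forall>v\<in>K. c v = a))"

definition clique_chromatic_number :: "'a set \<Rightarrow> 'a set set \<Rightarrow> nat" where
  "clique_chromatic_number V E = (LEAST k. \<exists>c. clique_coloring V E k c)"

text \<open>
  The distribution of the edge set of the binomial random graph on \<open>{1..n}\<close>: independent
  Bernoulli indicators, one for each of the pairs in \<open>[{1..n}]\<^bsup>2\<^esup>\<close>.
\<close>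

definition Gnp :: "nat \<Rightarrow> real \<Rightarrow> nat set set pmf" where
  "Gnp n p =
     map_pmf (\<lambda>b. {e \<in> [{1..n}]\<^bsup>2\<^esup>. b e}) (Pi_pmf ([{1..n}]\<^bsup>2\<^esup>) False (\<lambda>_. bernoulli_pmf p))"

end

theory Submission
  imports Defs "HOL-Real_Asymp.Real_Asymp"
begin

text \<open>
  Write \<open>L\<close> for \<open>ln n\<close>. The colouring has two layers.

  Let \<open>m\<close> be about \<open>(5/2) \<epsilon> L / p\<close>. A vertex beyond \<open>m\<close> that has a neighbour \<open>i \<le> m\<close> is given such an
  \<open>i\<close> as its colour. No maximal clique is monochromatic in such a colour, because \<open>i\<close> itself is outside
  its neighbourhood and extends every clique inside it. A vertex beyond \<open>m\<close> escapes with probability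
  \<open>(1 - p)^m \<le> n powr (- 5 \<epsilon> / 2)\<close>, and since \<open>n powr \<epsilon> = p n powr (2/5)\<close> at most about
  \<open>p powr (- 5/2)\<close> vertices are expected to be left over, which dominates the \<open>m\<close> vertices never
  coloured this way.

  It remains to colour these leftover vertices with \<open>o(1/p)\<close> new colours, which is negligible because
  \<open>p \<ge> 2 n powr (- 2/5)\<close> forces \<open>\<epsilon> L \<ge> ln 2\<close>. As \<open>n p\<^sup>2\<close> is polynomially large, every pair of
  vertices has a common neighbour, so no edge is a maximal clique and triangle-free colour classes
  suffice. Classes of size \<open>p powr (- 3/2)\<close> would only give \<open>O(1/p)\<close> colours, so the classes have to be
  larger by a factor tending to infinity; the proof gains a factor of order \<open>sqrt L\<close>, and gives away
  \<open>L powr (1/4)\<close> of it to the Markov bound on the number of leftover vertices.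

  These classes are built greedily, one vertex at a time. A new vertex \<open>x\<close> can join a class \<open>D\<close> if its
  neighbourhood in \<open>D\<close> spans no edge. If \<open>D\<close> spans \<open>M\<close> edges, Harris' inequality gives this a probability
  of at least \<open>(1 - p\<^sup>2)^M\<close>. To keep \<open>M\<close> under control, \<open>x\<close> is also required to have at most \<open>d\<close>
  neighbours in \<open>D\<close>, with \<open>d\<close> twice the expected number; Markov's and again Harris' inequality show that
  this costs at most a factor 2. Then \<open>M \<le> s d\<close>, about \<open>2 p s\<^sup>2\<close>, where \<open>s\<close> is the maximal size of a
  class, and with \<open>s = p powr (- 3/2) sqrt L / 10\<close> the success probability is at least a small negative
  power of \<open>n\<close>. The edges from \<open>x\<close> to distinct classes are independent, and at all times at least \<open>h\<close> of
  the \<open>2 h\<close> classes are not full, where \<open>h\<close> is about \<open>40 / (L powr (1/4) p)\<close> and hence larger than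
  \<open>n powr (1/9) / L powr (1/4)\<close>. So all classes are blocked with a probability that is small enough for a
  union bound over all vertices (\<open>prob_no_sparse_coloring_le\<close>). The edges at \<open>x\<close> are independent of the
  past, so the induction over the vertices exposes a fresh star in each step.
\<close>

section \<open>Binomial random subsets\<close>

lemma prob_pair_pmf:
  "measure_pmf.prob (pair_pmf M N) {\<omega>. Q (fst \<omega>) (snd \<omega>)} =
     measure_pmf.expectation M (\<lambda>a. measure_pmf.prob N {b. Q a b})"
proof -
  have "ennreal (measure_pmf.prob (pair_pmf M N) {\<omega>. Q (fst \<omega>) (snd \<omega>)}) =
      (\<integral>\<^sup>+a. \<integral>\<^sup>+b. indicator {\<omega>. Q (fst \<omega>) (snd \<omega>)} (a, b) \<partial>N \<partial>M)"
    by (simp add: measure_pmf.emeasure_eq_measure[symmetric] nn_integral_pair_pmf'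
        flip: nn_integral_indicator)
  also have "\<dots> = (\<integral>\<^sup>+a. emeasure N {b. Q a b} \<partial>M)"
  proof (rule nn_integral_cong)
    fix a
    have "(\<lambda>b. indicator {\<omega>. Q (fst \<omega>) (snd \<omega>)} (a, b) :: ennreal) = indicator {b. Q a b}"
      by (auto simp: fun_eq_iff indicator_def)
    then show "(\<integral>\<^sup>+b. indicator {\<omega>. Q (fst \<omega>) (snd \<omega>)} (a, b) \<partial>N) = emeasure N {b. Q a b}"
      by simp
  qed
  also have "\<dots> = ennreal (measure_pmf.expectation M (\<lambda>a. measure_pmf.prob N {b. Q a b}))"
    by (simp add: measure_pmf.emeasure_eq_measure, rule nn_integral_eq_integral)
      (auto intro!: measure_pmf.integrable_const_bound[where B=1])
  finally show ?thesis
    by (simp add: Bochner_Integration.integral_nonneg)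
qed

lemma prob_pair_pmf_le:
  assumes "\<And>a. a \<in> set_pmf M \<Longrightarrow> measure_pmf.prob N {b. Q a b} \<le> q"
  shows "measure_pmf.prob (pair_pmf M N) {\<omega>. Q (fst \<omega>) (snd \<omega>)} \<le> q"
proof -
  have "measure_pmf.expectation M (\<lambda>a. measure_pmf.prob N {b. Q a b}) \<le> measure_pmf.expectation M (\<lambda>a. q)"
    by (intro integral_mono_AE measure_pmf.integrable_const
        measure_pmf.integrable_const_bound[where B=1]) (auto simp: AE_measure_pmf_iff assms)
  then show ?thesis
    by (simp add: prob_pair_pmf)
qed

lemma prob_pair_pmf_indep:
  "measure_pmf.prob (pair_pmf M N) {\<omega>. P (fst \<omega>) \<and> Q (snd \<omega>)} =
     measure_pmf.prob M {a. P a} * measure_pmf.prob N {b. Q b}"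
proof -
  have "(\<lambda>a. measure_pmf.prob N {b. P a \<and> Q b}) =
      (\<lambda>a. indicator {a. P a} a * measure_pmf.prob N {b. Q b})"
    by (auto simp: fun_eq_iff indicator_def)
  then show ?thesis
    using prob_pair_pmf[of M N "\<lambda>a b. P a \<and> Q b"] by simp
qed

text \<open>
  Markov's inequality for the number of events that occur.
\<close>

lemma prob_card_ge_le:
  fixes M :: "'a pmf" and t :: real
  assumes "finite I" "0 < t"
  shows "measure_pmf.prob M {\<omega>. t \<le> real (card {i\<in>I. Q i \<omega>})}
           \<le> (\<Sum>i\<in>I. measure_pmf.prob M {\<omega>. Q i \<omega>}) / t"
proof -
  have card_eq: "real (card {i\<in>I. Q i \<omega>}) = (\<Sum>i\<in>I. indicator {\<omega>. Q i \<omega>} \<omega>)" for \<omega>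
  proof -
    have "(\<Sum>i\<in>I. indicator {\<omega>. Q i \<omega>} \<omega>) = (\<Sum>i\<in>I. if Q i \<omega> then 1 else 0 :: real)"
      by (intro sum.cong) (auto simp: indicator_def)
    also have "\<dots> = real (card {i\<in>I. Q i \<omega>})"
      using \<open>finite I\<close> by (simp add: sum.If_cases Int_def)
    finally show ?thesis by simp
  qed
  have int: "integrable M (\<lambda>\<omega>. indicator {\<omega>. Q i \<omega>} \<omega> :: real)" for i
    by (intro measure_pmf.integrable_const_bound[where B=1]) auto
  have "measure_pmf.prob M {\<omega>\<in>space M. t \<le> (\<Sum>i\<in>I. indicator {\<omega>. Q i \<omega>} \<omega>)}
      \<le> measure_pmf.expectation M (\<lambda>\<omega>. \<Sum>i\<in>I. indicator {\<omega>. Q i \<omega>} \<omega>) / t"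
    using int \<open>0 < t\<close>
    by (intro integral_Markov_inequality_measure[where A="{}"]) (auto intro!: sum_nonneg)
  also have "measure_pmf.expectation M (\<lambda>\<omega>. \<Sum>i\<in>I. indicator {\<omega>. Q i \<omega>} \<omega>) =
      (\<Sum>i\<in>I. measure_pmf.prob M {\<omega>. Q i \<omega>})"
    using int by (subst Bochner_Integration.integral_sum) auto
  finally show ?thesis
    by (simp add: card_eq)
qed

text \<open>
  The binomial random graph is the instance in which \<open>S\<close> is the set of pairs. Working with subsets of an
  arbitrary set makes it possible to split the potential edges into independent blocks.
\<close>

definition random_subset :: "real \<Rightarrow> 'a set \<Rightarrow> 'a set pmf" where
  "random_subset p S =
     map_pmf (\<lambda>b. {e \<in> S. b e}) (Pi_pmf S False (\<lambda>_. bernoulli_pmf p))"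

lemma Gnp_eq_random_subset: "Gnp n p = random_subset p ([{1..n}]\<^bsup>2\<^esup>)"
  by (simp add: Gnp_def random_subset_def)

lemma random_subset_empty: "random_subset p {} = return_pmf {}"
  by (simp add: random_subset_def)

lemma random_subset_insert:
  assumes "finite S" "x \<notin> S"
  shows "random_subset p (insert x S) =
    bind_pmf (bernoulli_pmf p) (\<lambda>b. map_pmf (\<lambda>B. if b then insert x B else B) (random_subset p S))"
proof -
  have "{e \<in> insert x S. (f(x := y)) e} =
      (if y then insert x {e\<in>S. f e} else {e\<in>S. f e})" for f :: "'a \<Rightarrow> bool" and y
    using assms(2) by auto
  then show ?thesis
    using assms unfolding random_subset_def
    by (simp add: Pi_pmf_insert' map_bind_pmf map_pmf_def bind_assoc_pmf bind_return_pmf)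
qed

lemma set_random_subset: "finite S \<Longrightarrow> E \<in> set_pmf (random_subset p S) \<Longrightarrow> E \<subseteq> S"
  by (auto simp: random_subset_def)

lemma random_subset_union:
  assumes "finite S" "finite T" "S \<inter> T = {}"
  shows "random_subset p (S \<union> T) =
    map_pmf (\<lambda>\<omega>. fst \<omega> \<union> snd \<omega>) (pair_pmf (random_subset p S) (random_subset p T))"
  using assms
proof (induction S rule: finite_induct)
  case empty
  then show ?case
    by (simp add: random_subset_empty pair_return_pmf1 pmf.map_comp o_def)
next
  case (insert x S)
  have "random_subset p (insert x S \<union> T) = bind_pmf (bernoulli_pmf p)
     (\<lambda>b. map_pmf (\<lambda>B. if b then insert x B else B) (random_subset p (S \<union> T)))"
    using insert by (simp add: random_subset_insert)
  also have "random_subset p (S \<union> T) =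
      map_pmf (\<lambda>\<omega>. fst \<omega> \<union> snd \<omega>) (pair_pmf (random_subset p S) (random_subset p T))"
    using insert by simp
  finally show ?case
    using insert
    by (simp add: random_subset_insert pair_pmf_def map_pmf_def bind_assoc_pmf bind_return_pmf
        if_distrib[of "\<lambda>A. A \<union> _"] cong: if_cong)
qed

lemma prob_random_subset_insert:
  assumes "finite S" "x \<notin> S" "0 \<le> p" "p \<le> 1"
  shows "measure_pmf.prob (random_subset p (insert x S)) {E. Q E} =
    p * measure_pmf.prob (random_subset p S) {E. Q (insert x E)} +
    (1 - p) * measure_pmf.prob (random_subset p S) {E. Q E}"
proof -
  have "random_subset p (insert x S) = map_pmf (\<lambda>\<omega>. if fst \<omega> then insert x (snd \<omega>) else snd \<omega>)
      (pair_pmf (bernoulli_pmf p) (random_subset p S))"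
    using assms by (simp add: random_subset_insert pair_pmf_def map_pmf_def bind_assoc_pmf bind_return_pmf
        cong: if_cong)
  then have "measure_pmf.prob (random_subset p (insert x S)) {E. Q E} =
    measure_pmf.prob (pair_pmf (bernoulli_pmf p) (random_subset p S))
      {\<omega>. Q (if fst \<omega> then insert x (snd \<omega>) else snd \<omega>)}"
    by (simp add: vimage_def)
  also have "\<dots> = measure_pmf.expectation (bernoulli_pmf p)
      (\<lambda>b. measure_pmf.prob (random_subset p S) {E. Q (if b then insert x E else E)})"
    by (rule prob_pair_pmf)
  finally show ?thesis
    using assms by simp
qed

lemma random_subset_restrict:
  assumes "finite S" "T \<subseteq> S"
  shows "map_pmf (\<lambda>E. E \<inter> T) (random_subset p S) = random_subset p T"
proof -
  have "random_subset p S = map_pmf (\<lambda>\<omega>. fst \<omega> \<union> snd \<omega>)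
      (pair_pmf (random_subset p T) (random_subset p (S - T)))"
    using assms random_subset_union[of T "S - T" p] finite_subset[OF assms(2,1)]
    by (auto simp: Un_absorb1)
  also have "map_pmf (\<lambda>E. E \<inter> T) \<dots> =
      map_pmf fst (pair_pmf (random_subset p T) (random_subset p (S - T)))"
    unfolding pmf.map_comp o_def
  proof (rule map_pmf_cong[OF refl])
    fix \<omega> assume "\<omega> \<in> set_pmf (pair_pmf (random_subset p T) (random_subset p (S - T)))"
    then have "fst \<omega> \<subseteq> T" "snd \<omega> \<subseteq> S - T"
      using assms finite_subset[OF assms(2,1)] by (auto dest!: set_random_subset[rotated])
    then show "(fst \<omega> \<union> snd \<omega>) \<inter> T = fst \<omega>" by auto
  qed
  finally show ?thesis
    by (simp add: map_fst_pair_pmf)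
qed

lemma prob_random_subset_restrict:
  assumes "finite S" "T \<subseteq> S"
  shows "measure_pmf.prob (random_subset p S) {E. Q (E \<inter> T)} =
    measure_pmf.prob (random_subset p T) {E. Q E}"
  by (simp flip: random_subset_restrict[OF assms, of p] add: vimage_def)

text \<open>
  Events that look at disjoint blocks of a random subset are independent, which is how distinct colour
  classes and distinct potential common neighbours get to multiply their failure probabilities.
\<close>

lemma prob_random_subset_indep_le:
  assumes "finite I" "\<And>i. i \<in> I \<Longrightarrow> finite (T i)" "disjoint_family_on T I" "finite S" "(\<Union>i\<in>I. T i) \<subseteq> S"
    and "0 \<le> q"
    and "\<And>i. i \<in> I \<Longrightarrow> measure_pmf.prob (random_subset p (T i)) {E. Q i E} \<le> q"
  shows "measure_pmf.prob (random_subset p S) {E. \<forall>i\<in>I. Q i (E \<inter> T i)} \<le> q ^ card I"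
  using assms
proof (induction I arbitrary: S rule: finite_induct)
  case empty
  then show ?case by simp
next
  case (insert i I)
  define R where "R = S - T i"
  have fin: "finite R" "finite (T i)" and S: "S = T i \<union> R" "T i \<inter> R = {}"
    using insert.prems by (auto simp: R_def)
  have dj: "T j \<inter> T i = {}" if "j \<in> I" for j
    using insert.prems(2) insert.hyps(2) that by (auto simp: disjoint_family_on_def)
  have sub: "(\<Union>j\<in>I. T j) \<subseteq> R"
    using insert.prems(4) dj by (auto simp: R_def)
  have "measure_pmf.prob (random_subset p S) {E. \<forall>j\<in>insert i I. Q j (E \<inter> T j)} =
    measure_pmf.prob (pair_pmf (random_subset p (T i)) (random_subset p R))
      {\<omega>. \<forall>j\<in>insert i I. Q j ((fst \<omega> \<union> snd \<omega>) \<inter> T j)}"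
    by (simp add: S(1) random_subset_union[OF fin(2,1) S(2)] vimage_def)
  also have "\<dots> = measure_pmf.prob (pair_pmf (random_subset p (T i)) (random_subset p R))
      {\<omega>. Q i (fst \<omega>) \<and> (\<forall>j\<in>I. Q j (snd \<omega> \<inter> T j))}"
  proof (intro measure_pmf.finite_measure_eq_AE AE_pmfI)
    fix \<omega> assume "\<omega> \<in> set_pmf (pair_pmf (random_subset p (T i)) (random_subset p R))"
    then have *: "fst \<omega> \<subseteq> T i" "snd \<omega> \<subseteq> R"
      using fin by (auto dest!: set_random_subset[rotated])
    then have "(fst \<omega> \<union> snd \<omega>) \<inter> T i = fst \<omega>"
      using S(2) by auto
    moreover have "(fst \<omega> \<union> snd \<omega>) \<inter> T j = snd \<omega> \<inter> T j" if "j \<in> I" for j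
      using * dj[OF that] by auto
    ultimately show "(\<omega> \<in> {\<omega>. \<forall>j\<in>insert i I. Q j ((fst \<omega> \<union> snd \<omega>) \<inter> T j)}) =
        (\<omega> \<in> {\<omega>. Q i (fst \<omega>) \<and> (\<forall>j\<in>I. Q j (snd \<omega> \<inter> T j))})"
      by simp
  qed auto
  also have "\<dots> = measure_pmf.prob (random_subset p (T i)) {E. Q i E} *
      measure_pmf.prob (random_subset p R) {E. \<forall>j\<in>I. Q j (E \<inter> T j)}"
    by (rule prob_pair_pmf_indep)
  also have "\<dots> \<le> q * q ^ card I"
    using insert.prems fin(1) sub
    by (intro mult_mono insert.IH) (auto simp: disjoint_family_on_def)
  finally show ?case
    using insert.hyps by simp
qed

lemma prob_random_subset_eq_empty:
  assumes "finite S" "0 \<le> p" "p \<le> 1" 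
  shows "measure_pmf.prob (random_subset p S) {E. E = {}} = (1 - p) ^ card S"
  using assms(1)
proof (induction S rule: finite_induct)
  case empty
  then show ?case by (simp add: random_subset_empty)
next
  case (insert x S)
  then show ?case
    using assms by (simp add: prob_random_subset_insert del: singleton_conv singleton_conv2)
qed

lemma prob_random_subset_contains:
  assumes "finite S" "0 \<le> p" "p \<le> 1" 
  shows "measure_pmf.prob (random_subset p S) {E. S \<subseteq> E} = p ^ card S"
  using assms(1)
proof (induction S rule: finite_induct)
  case empty
  then show ?case by (simp add: random_subset_empty)
next
  case (insert x S)
  have "measure_pmf.prob (random_subset p S) {E. insert x S \<subseteq> E} = measure_pmf.prob (random_subset p S) {}"
    using insert.hyps
    by (intro measure_pmf.finite_measure_eq_AE AE_pmfI) (auto dest!: set_random_subset[rotated])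
  moreover have "measure_pmf.prob (random_subset p S) {E. insert x S \<subseteq> insert x E} =
      measure_pmf.prob (random_subset p S) {E. S \<subseteq> E}"
    using insert.hyps by (intro arg_cong2[where f=measure_pmf.prob]) auto
  ultimately show ?case using insert assms
    by (simp add: prob_random_subset_insert del: insert_subset)
qed

text \<open>
  Harris' inequality for decreasing events, by induction on the ground set. Conditioning on whether
  \<open>x\<close> is chosen reduces it to the two-point case of Chebyshev's sum inequality: both conditional
  probabilities drop when \<open>x\<close> is chosen, so the product of the two drops is nonnegative.
\<close>

lemma harris_random_subset:
  assumes "finite S" "0 \<le> p" "p \<le> 1"
    and "antimono P" "antimono Q"
  shows "measure_pmf.prob (random_subset p S) {E. P E} * measure_pmf.prob (random_subset p S) {E. Q E}
       \<le> measure_pmf.prob (random_subset p S) {E. P E \<and> Q E}"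
  using assms(1,4,5)
proof (induction S arbitrary: P Q rule: finite_induct)
  case empty
  then show ?case by (auto simp: random_subset_empty indicator_def)
next
  case (insert x S)
  let ?\<mu> = "\<lambda>P. measure_pmf.prob (random_subset p S) {E. P E}"
  let ?P = "\<lambda>E. P (insert x E)" and ?Q = "\<lambda>E. Q (insert x E)"
  have anti: "antimono (\<lambda>E. R (insert x E))" if "antimono R" for R :: "'a set \<Rightarrow> bool"
    by (intro antimonoI antimonoD[OF that] Set.insert_mono)
  have le: "?\<mu> ?P \<le> ?\<mu> P" "?\<mu> ?Q \<le> ?\<mu> Q"
    using antimonoD[OF insert.prems(1) subset_insertI] antimonoD[OF insert.prems(2) subset_insertI]
    by (auto intro!: measure_pmf.finite_measure_mono)
  have "(p * ?\<mu> ?P + (1 - p) * ?\<mu> P) * (p * ?\<mu> ?Q + (1 - p) * ?\<mu> Q) =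
      p * (?\<mu> ?P * ?\<mu> ?Q) + (1 - p) * (?\<mu> P * ?\<mu> Q)
        - p * (1 - p) * ((?\<mu> P - ?\<mu> ?P) * (?\<mu> Q - ?\<mu> ?Q))"
    by (simp add: algebra_simps)
  also have "\<dots> \<le> p * (?\<mu> ?P * ?\<mu> ?Q) + (1 - p) * (?\<mu> P * ?\<mu> Q)"
    using assms(2,3) le by (simp add: mult_nonneg_nonneg)
  also have "\<dots> \<le> p * ?\<mu> (\<lambda>E. ?P E \<and> ?Q E) + (1 - p) * ?\<mu> (\<lambda>E. P E \<and> Q E)"
    using assms(2,3) by (intro add_mono mult_left_mono insert.IH anti insert.prems) auto
  finally show ?case
    using insert.hyps assms(2,3) by (simp add: prob_random_subset_insert)
qed

text \<open>
  The events of not containing a given pair are decreasing, so Harris' inequality lets them be treated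
  as if they were independent.
\<close>

lemma prob_avoids_pairs_ge:
  assumes "finite T" "0 \<le> p" "p \<le> 1" "F \<subseteq> [T]\<^bsup>2\<^esup>"
  shows "(1 - p^2) ^ card F \<le> measure_pmf.prob (random_subset p T) {E. \<forall>f\<in>F. \<not> f \<subseteq> E}"
proof -
  have "finite F"
    using assms finite_imp_finite_nsets finite_subset by blast
  then show ?thesis
    using assms(4)
  proof (induction F rule: finite_induct)
    case (insert f F)
    let ?\<mu> = "\<lambda>P. measure_pmf.prob (random_subset p T) {E. P E}"
    have f: "f \<subseteq> T" "finite f" "card f = 2"
      using insert.prems by (auto simp: nsets_def)
    have "?\<mu> (\<lambda>E. f \<subseteq> E \<inter> f) = p\<^sup>2"
      using prob_random_subset_restrict[OF assms(1) f(1), of p "\<lambda>E. f \<subseteq> E"]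
        prob_random_subset_contains[OF f(2) assms(2,3)] f(3) by simp
    then have eq: "?\<mu> (\<lambda>E. \<not> f \<subseteq> E) = 1 - p\<^sup>2"
      using measure_pmf.prob_compl[of "{E. f \<subseteq> E}" "random_subset p T"]
      by (simp add: Compl_eq_Diff_UNIV[symmetric] Collect_neg_eq[symmetric])
    have "(1 - p^2) ^ card (insert f F) \<le> ?\<mu> (\<lambda>E. \<not> f \<subseteq> E) * ?\<mu> (\<lambda>E. \<forall>f\<in>F. \<not> f \<subseteq> E)"
      using insert assms(2,3) by (simp add: eq mult_left_mono power_le_one)
    also have "\<dots> \<le> ?\<mu> (\<lambda>E. \<not> f \<subseteq> E \<and> (\<forall>f\<in>F. \<not> f \<subseteq> E))"
      using assms by (intro harris_random_subset) (simp_all add: monotone_def, blast+)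
    finally show ?case by simp
  qed simp
qed

text \<open>
  This is the chance that a vertex can join a colour class: \<open>T\<close> is the set of potential edges from the
  vertex to the class, and the pairs in \<open>F\<close> are those that would close a triangle with an edge of the
  class. By Markov's inequality the bound \<open>d\<close> on the number of edges holds with probability at least
  \<open>1/2\<close>, and Harris' inequality combines it with the avoidance of the triangles.
\<close>

lemma prob_small_and_avoids_pairs_ge:
  assumes "finite T" "0 < p" "p \<le> 1" "F \<subseteq> [T]\<^bsup>2\<^esup>" "card F \<le> M" "card T \<le> s" "2 * p * real s \<le> real d"
  shows "(1 - p^2) ^ M / 2 \<le>
    measure_pmf.prob (random_subset p T) {E. card (E \<inter> T) \<le> d \<and> (\<forall>f\<in>F. \<not> f \<subseteq> E)}"
proof -
  let ?\<mu> = "\<lambda>P. measure_pmf.prob (random_subset p T) {E. P E}"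
  have "?\<mu> (\<lambda>E. e \<in> E) = p" if "e \<in> T" for e
    using prob_random_subset_restrict[OF assms(1), of "{e}" p "\<lambda>E. {e} \<subseteq> E"] that
      prob_random_subset_contains[of "{e}" p] assms(2,3) by simp
  then have "?\<mu> (\<lambda>E. real d + 1 \<le> real (card {e\<in>T. e \<in> E})) \<le> real (card T) * p / (real d + 1)"
    using prob_card_ge_le[OF assms(1), of "real d + 1" "random_subset p T" "\<lambda>e E. e \<in> E"] by simp
  also have "\<dots> \<le> 1 / 2"
  proof -
    have "real (card T) * p \<le> real s * p"
      using assms by (intro mult_right_mono) auto
    then show ?thesis
      using assms(7) by (simp add: field_simps)
  qed
  also have "(\<lambda>E. real d + 1 \<le> real (card {e\<in>T. e \<in> E})) = (\<lambda>E. d < card (E \<inter> T))"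
    by (auto simp: Int_def conj_commute fun_eq_iff)
  finally have "1 / 2 \<le> 1 - ?\<mu> (\<lambda>E. d < card (E \<inter> T))"
    by simp
  also have "\<dots> = ?\<mu> (\<lambda>E. card (E \<inter> T) \<le> d)"
    using measure_pmf.prob_compl[of "{E. d < card (E \<inter> T)}" "random_subset p T"]
    by (simp add: Compl_eq_Diff_UNIV[symmetric] Collect_neg_eq[symmetric] not_less)
  finally have "1 / 2 * (1 - p^2) ^ M \<le> ?\<mu> (\<lambda>E. card (E \<inter> T) \<le> d) * ?\<mu> (\<lambda>E. \<forall>f\<in>F. \<not> f \<subseteq> E)"
    using assms(2,3) prob_avoids_pairs_ge[OF assms(1) _ assms(3,4)]
      power_decreasing[OF assms(5), of "1 - p^2"]
    by (intro mult_mono) (auto simp: power_le_one intro: order.trans)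
  also have "\<dots> \<le> ?\<mu> (\<lambda>E. card (E \<inter> T) \<le> d \<and> (\<forall>f\<in>F. \<not> f \<subseteq> E))"
  proof (intro harris_random_subset)
    show "antimono (\<lambda>E. card (E \<inter> T) \<le> d)"
      using assms(1) by (auto simp: monotone_def intro: order.trans[OF card_mono])
    show "antimono (\<lambda>E. \<forall>f\<in>F. \<not> f \<subseteq> E)"
      by (simp add: monotone_def) blast
  qed (use assms in auto)
  finally show ?thesis by simp
qed

section \<open>Greedy colouring with sparse triangle-free classes\<close>

definition color_class :: "('a \<Rightarrow> nat) \<Rightarrow> 'a set \<Rightarrow> nat \<Rightarrow> 'a set" where
  "color_class c W j = {u \<in> W. c u = j}"

text \<open>
  A partial colouring of \<open>W\<close> into triangle-free classes of bounded size. The bound on the edges inside a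
  class is proportional to the current size of the class because each vertex that joins brings at most
  \<open>d\<close> new edges.
\<close>

definition sparse_coloring :: "nat \<Rightarrow> nat \<Rightarrow> nat \<Rightarrow> 'a set set \<Rightarrow> 'a set \<Rightarrow> ('a \<Rightarrow> nat) \<Rightarrow> bool" where
  "sparse_coloring k s d E W c \<longleftrightarrow> c ` W \<subseteq> {..<k} \<and>
     (\<forall>j. card (color_class c W j) \<le> s \<and>
          card (E \<inter> [color_class c W j]\<^bsup>2\<^esup>) \<le> d * card (color_class c W j) \<and>
          (\<forall>K \<subseteq> color_class c W j. [K]\<^bsup>2\<^esup> \<subseteq> E \<longrightarrow> card K \<le> 2))"

definition star :: "'a \<Rightarrow> 'a set \<Rightarrow> 'a set set" where
  "star x V = (\<lambda>u. {u, x}) ` V"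

lemma nsets_2_insert: "x \<notin> V \<Longrightarrow> [insert x V]\<^bsup>2\<^esup> = [V]\<^bsup>2\<^esup> \<union> star x V"
  by (auto simp: nsets_2_eq star_def insert_commute)

lemma nsets_2_disjoint_star: "x \<notin> V \<Longrightarrow> [V]\<^bsup>2\<^esup> \<inter> star x X = {}"
  by (auto simp: nsets_2_eq star_def doubleton_eq_iff)

lemma inj_on_star_edge: "x \<notin> V \<Longrightarrow> inj_on (\<lambda>u. {u, x}) V"
  by (auto simp: inj_on_def doubleton_eq_iff)

lemma finite_star: "finite V \<Longrightarrow> finite (star x V)"
  by (simp add: star_def)

lemma color_class_fresh: "x \<notin> W \<Longrightarrow>
  color_class (c(x := j)) (insert x W) i = (if i = j then insert x (color_class c W i) else color_class c W i)"
  by (auto simp: color_class_def)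

lemma sparse_coloring_add_star:
  assumes "sparse_coloring k s d A W c" "W \<subseteq> V" "x \<notin> V" "A \<subseteq> [V]\<^bsup>2\<^esup>" "B \<subseteq> star x V"
  shows "sparse_coloring k s d (A \<union> B) W c"
proof -
  have "(A \<union> B) \<inter> [color_class c W j]\<^bsup>2\<^esup> = A \<inter> [color_class c W j]\<^bsup>2\<^esup>" for j
    using assms nsets_2_disjoint_star[of x "color_class c W j" V] by (auto simp: color_class_def)
  moreover have "[K]\<^bsup>2\<^esup> \<subseteq> A" if "K \<subseteq> color_class c W j" "[K]\<^bsup>2\<^esup> \<subseteq> A \<union> B" for K j
  proof -
    have "x \<notin> K" using that assms by (auto simp: color_class_def)
    then show ?thesis using that assms nsets_2_disjoint_star[of x K V] by auto
  qed
  ultimately show ?thesis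
    using assms(1) unfolding sparse_coloring_def by (metis (no_types, lifting))
qed

text \<open>
  The assumption \<open>deg\<close> preserves the bound on the edges inside the class, and \<open>tri\<close> keeps the class
  triangle-free: a triangle created by \<open>x\<close> consists of \<open>x\<close> and an old edge \<open>e\<close> inside \<open>D\<close> whose two ends
  are both joined to \<open>x\<close>.
\<close>

lemma sparse_coloring_extend:
  assumes col: "sparse_coloring k s d A W c" and fin: "finite V" and "W \<subseteq> V" "x \<notin> V"
    and A: "A \<subseteq> [V]\<^bsup>2\<^esup>" and B: "B \<subseteq> star x V" and "j < k"
    and D: "D = color_class c W j" and room: "card D < s"
    and deg: "card (B \<inter> star x D) \<le> d"
    and tri: "\<forall>e \<in> A \<inter> [D]\<^bsup>2\<^esup>. \<not> star x e \<subseteq> B"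
  shows "sparse_coloring k s d (A \<union> B) (insert x W) (c(x := j))"
proof -
  have x: "x \<notin> W" "x \<notin> D" and finD: "finite D"
    using assms finite_subset[OF \<open>W \<subseteq> V\<close> fin] by (auto simp: color_class_def)
  have old: "sparse_coloring k s d (A \<union> B) W c"
    by (rule sparse_coloring_add_star[OF col \<open>W \<subseteq> V\<close> \<open>x \<notin> V\<close> A B])
  have "card ((A \<union> B) \<inter> [insert x D]\<^bsup>2\<^esup>) \<le> d * card (insert x D)"
  proof -
    have "(A \<union> B) \<inter> [insert x D]\<^bsup>2\<^esup> \<subseteq> ((A \<union> B) \<inter> [D]\<^bsup>2\<^esup>) \<union> (B \<inter> star x D)"
      using A nsets_2_disjoint_star[OF \<open>x \<notin> V\<close>, of D] x(2) by (auto simp: nsets_2_insert)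
    then have "card ((A \<union> B) \<inter> [insert x D]\<^bsup>2\<^esup>) \<le> card ((A \<union> B) \<inter> [D]\<^bsup>2\<^esup>) + card (B \<inter> star x D)"
      using finD by (intro order.trans[OF card_mono card_Un_le]) (auto simp: finite_star finite_imp_finite_nsets)
    also have "\<dots> \<le> d * card D + d"
      using old deg unfolding sparse_coloring_def D by (intro add_mono) blast+
    finally show ?thesis
      using x(2) finD by simp
  qed
  moreover have "card K \<le> 2" if K: "K \<subseteq> insert x D" "[K]\<^bsup>2\<^esup> \<subseteq> A \<union> B" for K
  proof (cases "x \<in> K")
    case False
    then have "K \<subseteq> color_class c W j" using K D by auto
    then show ?thesis using old K unfolding sparse_coloring_def by blast
  next
    case True
    let ?K = "K - {x}"
    have sub: "?K \<subseteq> D" and finK: "finite ?K"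
      using K finD finite_subset by auto
    have "[?K]\<^bsup>2\<^esup> \<subseteq> A \<union> B"
      using K(2) nsets_mono[of ?K K 2] by auto
    then have "card ?K \<le> 2"
      using old sub unfolding sparse_coloring_def D by blast
    moreover have "card ?K \<noteq> 2"
    proof
      assume two: "card ?K = 2"
      then have e: "?K \<in> [K]\<^bsup>2\<^esup>" "?K \<in> [D]\<^bsup>2\<^esup>"
        using finK sub by (auto simp: nsets_def)
      then have "?K \<in> A"
        using K(2) B nsets_2_disjoint_star[OF x(2), of V] by auto
      moreover have "star x ?K \<subseteq> B"
      proof
        fix f assume "f \<in> star x ?K"
        then obtain u where u: "f = {u, x}" "u \<in> K" "u \<noteq> x"
          by (auto simp: star_def)
        then have "f \<in> A \<union> B"
          using K(2) True doubleton_in_nsets_2[of u x K] by blast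
        moreover have "f \<notin> A"
          using A \<open>x \<notin> V\<close> u by (auto dest: subsetD)
        ultimately show "f \<in> B" by auto
      qed
      ultimately show False
        using tri e(2) by blast
    qed
    ultimately show ?thesis
      using True finK by (simp add: card_Diff_singleton)
  qed
  moreover have "card (insert x D) \<le> s"
    using room x(2) finD by simp
  ultimately show ?thesis
    using old \<open>j < k\<close> unfolding sparse_coloring_def color_class_fresh[OF x(1)] D
    by auto
qed

text \<open>
  Full classes have \<open>s\<close> vertices each, so at most \<open>h\<close> of the \<open>2 h\<close> classes can be full.
\<close>

lemma sparse_coloring_many_open_classes:
  assumes "sparse_coloring (2 * h) s d E W c" "finite W" "card W \<le> h * s" "0 < s"
  shows "h \<le> card {j. j < 2 * h \<and> card (color_class c W j) < s}"
proof -
  let ?O = "{j. j < 2 * h \<and> card (color_class c W j) < s}"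
  let ?F = "{j. j < 2 * h \<and> \<not> card (color_class c W j) < s}"
  have "s * card ?F = (\<Sum>j\<in>?F. s)" by simp
  also have "\<dots> \<le> (\<Sum>j\<in>?F. card (color_class c W j))"
    by (intro sum_mono) auto
  also have "\<dots> = card (\<Union>j\<in>?F. color_class c W j)"
    using assms(2) by (intro card_UN_disjoint[symmetric]) (auto simp: color_class_def)
  also have "\<dots> \<le> card W"
    using assms(2) by (intro card_mono) (auto simp: color_class_def)
  finally have "card ?F \<le> h"
    using assms(3,4) by (metis mult.commute mult_le_cancel1 order.trans)
  moreover have "card ?O + card ?F = card {..<2 * h}"
    by (subst card_Un_disjoint[symmetric]) (auto intro!: arg_cong[where f=card] simp del: card_lessThan)
  ultimately show ?thesis by simp
qed

definition blocked :: "nat \<Rightarrow> 'a set set \<Rightarrow> 'a \<Rightarrow> 'a set \<Rightarrow> 'a set set \<Rightarrow> bool" where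
  "blocked d A x D B \<longleftrightarrow> \<not> (card (B \<inter> star x D) \<le> d \<and> (\<forall>e \<in> A \<inter> [D]\<^bsup>2\<^esup>. \<not> star x e \<subseteq> B))"

text \<open>
  The stars from \<open>x\<close> to distinct classes are disjoint, hence independent, and each class is open to \<open>x\<close>
  with the probability of \<open>prob_small_and_avoids_pairs_ge\<close>.
\<close>

lemma prob_all_blocked_le:
  assumes p: "0 < p" "p \<le> 1" and d: "2 * p * real s \<le> real d"
    and col: "sparse_coloring k s d A W c" and fin: "finite V" and "W \<subseteq> V" "x \<notin> V" 
    and h: "h \<le> card J" and "finite J"
  shows "measure_pmf.prob (random_subset p (star x V)) {B. \<forall>j\<in>J. blocked d A x (color_class c W j) B}
    \<le> (1 - (1 - p\<^sup>2) ^ (s * d) / 2) ^ h"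
proof -
  let ?D = "color_class c W"
  let ?q = "1 - (1 - p\<^sup>2) ^ (s * d) / 2"
  have DV: "?D j \<subseteq> V" and finD: "finite (?D j)" for j
    using \<open>W \<subseteq> V\<close> finite_subset[OF \<open>W \<subseteq> V\<close> fin] by (auto simp: color_class_def)
  have pow: "0 \<le> (1 - p\<^sup>2) ^ (s * d)" "(1 - p\<^sup>2) ^ (s * d) \<le> 1"
    using p by (auto intro!: power_le_one simp: power_le_one)
  have restrict: "blocked d A x (?D j) (B \<inter> star x (?D j)) \<longleftrightarrow> blocked d A x (?D j) B" for j B
  proof -
    have "star x e \<subseteq> star x (?D j)" if "e \<in> [?D j]\<^bsup>2\<^esup>" for e
      using that by (auto simp: star_def nsets_def)
    then show ?thesis
      unfolding blocked_def by (auto simp: Int_assoc)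
  qed
  have "measure_pmf.prob (random_subset p (star x V)) {B. \<forall>j\<in>J. blocked d A x (?D j) B} =
     measure_pmf.prob (random_subset p (star x V)) {B. \<forall>j\<in>J. blocked d A x (?D j) (B \<inter> star x (?D j))}"
    by (simp add: restrict)
  also have "\<dots> \<le> ?q ^ card J"
  proof (rule prob_random_subset_indep_le)
    show "disjoint_family_on (\<lambda>j. star x (?D j)) J"
      using DV \<open>x \<notin> V\<close>
      by (auto simp: disjoint_family_on_def star_def doubleton_eq_iff color_class_def)
    show "(\<Union>j\<in>J. star x (?D j)) \<subseteq> star x V"
      using DV by (auto simp: star_def)
    fix j assume "j \<in> J"
    let ?T = "star x (?D j)"
    let ?F = "star x ` (A \<inter> [?D j]\<^bsup>2\<^esup>)"
    have xD: "x \<notin> ?D j" using DV \<open>x \<notin> V\<close> by auto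
    have "(1 - p\<^sup>2) ^ (s * d) / 2 \<le> 
      measure_pmf.prob (random_subset p ?T) {B. card (B \<inter> ?T) \<le> d \<and> (\<forall>f\<in>?F. \<not> f \<subseteq> B)}"
    proof (rule prob_small_and_avoids_pairs_ge)
      show "?F \<subseteq> [?T]\<^bsup>2\<^esup>"
        using inj_on_star_edge[OF xD]
        by (auto simp: nsets_def star_def card_image inj_on_subset)
      have "card ?F \<le> card (A \<inter> [?D j]\<^bsup>2\<^esup>)"
        using finD by (intro card_image_le) (simp add: finite_imp_finite_nsets)
      also have "\<dots> \<le> d * card (?D j)"
        using col unfolding sparse_coloring_def by blast
      also have "\<dots> \<le> d * s"
        using col unfolding sparse_coloring_def by simp
      finally show "card ?F \<le> s * d"
        by (simp add: mult.commute)
      show "card ?T \<le> s"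
        using col card_image[OF inj_on_star_edge[OF xD]]
        unfolding sparse_coloring_def star_def by simp
    qed (use p d finD in \<open>auto simp: finite_star\<close>)
    also have "{B. card (B \<inter> ?T) \<le> d \<and> (\<forall>f\<in>?F. \<not> f \<subseteq> B)} = - {B. blocked d A x (?D j) B}"
      by (auto simp: blocked_def)
    also have "measure_pmf.prob (random_subset p ?T) \<dots> =
        1 - measure_pmf.prob (random_subset p ?T) {B. blocked d A x (?D j) B}"
      using measure_pmf.prob_compl[of "{B. blocked d A x (?D j) B}" "random_subset p ?T"]
      by (simp add: Compl_eq_Diff_UNIV)
    finally show "measure_pmf.prob (random_subset p ?T) {B. blocked d A x (?D j) B} \<le> ?q"
      by simp
  qed (use assms finD pow in \<open>auto simp: finite_star\<close>)
  also have "\<dots> \<le> ?q ^ h"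
    using h pow by (intro power_decreasing) auto
  finally show ?thesis .
qed

text \<open>
  The vertices left to the greedy procedure. The first \<open>m\<close> vertices always belong to it, even if they
  have neighbours among themselves, since this makes no difference to the size estimate.
\<close>

definition uncaptured :: "nat \<Rightarrow> nat \<Rightarrow> nat set set \<Rightarrow> nat set" where
  "uncaptured m n E = {v \<in> {1..n}. m < v \<longrightarrow> (\<forall>i\<in>{1..m}. {i, v} \<notin> E)}"

lemma uncaptured_Suc:
  assumes "A \<subseteq> [{1..v}]\<^bsup>2\<^esup>" "B \<subseteq> star (Suc v) {1..v}"
  shows "uncaptured m (Suc v) (A \<union> B) \<inter> {1..v} = uncaptured m v A"
proof -
  have "{i, u} \<notin> B" if "i \<in> {1..m}" "u \<in> {1..v}" "m < u" for i u
  proof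
    assume "{i, u} \<in> B"
    then have "Suc v \<in> {i, u}"
      using assms(2) by (auto simp: star_def)
    then show False
      using that by simp
  qed
  then have "(m < u \<longrightarrow> (\<forall>i\<in>{1..m}. {i, u} \<notin> A \<union> B)) \<longleftrightarrow> (m < u \<longrightarrow> (\<forall>i\<in>{1..m}. {i, u} \<notin> A))"
    if "u \<in> {1..v}" for u
    using that by blast
  moreover have "u \<in> {1..Suc v}" if "u \<in> {1..v}" for u
    using that by simp
  ultimately show ?thesis
    unfolding uncaptured_def by blast
qed

text \<open>
  One greedy step. The graph on the first \<open>v\<close> vertices is \<open>A\<close>, and \<open>B\<close> consists of the edges from the new
  vertex to the old ones. If the new vertex is captured, nothing has to be done.
\<close>

lemma sparse_coloring_step:
  assumes A: "A \<subseteq> [{1..v}]\<^bsup>2\<^esup>" and B: "B \<subseteq> star (Suc v) {1..v}"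
    and col: "sparse_coloring k s d A (uncaptured m v A) c"
    and free: "j < k" "card (color_class c (uncaptured m v A) j) < s"
      "\<not> blocked d A (Suc v) (color_class c (uncaptured m v A) j) B"
  shows "\<exists>c. sparse_coloring k s d (A \<union> B) (uncaptured m (Suc v) (A \<union> B)) c"
proof -
  let ?W = "uncaptured m v A" and ?W' = "uncaptured m (Suc v) (A \<union> B)"
  have sub: "?W \<subseteq> {1..v}" "?W' \<subseteq> insert (Suc v) {1..v}"
    unfolding uncaptured_def by auto
  have step: "?W' \<inter> {1..v} = ?W"
    by (rule uncaptured_Suc[OF A B])
  have fresh: "Suc v \<notin> {1..v}" by simp
  show ?thesis
  proof (cases "Suc v \<in> ?W'")
    case True
    then have "?W' = insert (Suc v) ?W"
      using step sub by blast
    moreover have "sparse_coloring k s d (A \<union> B) (insert (Suc v) ?W) (c(Suc v := j))"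
      using free unfolding blocked_def
      by (intro sparse_coloring_extend[OF col finite_atLeastAtMost sub(1) fresh A B _ refl]) blast+
    ultimately show ?thesis by auto
  next
    case False
    then have "?W' = ?W"
      using step sub by blast
    then show ?thesis
      using sparse_coloring_add_star[OF col sub(1) fresh A B] by auto
  qed
qed

text \<open>
  The greedy procedure, as an induction on the number of vertices. For each graph on the first \<open>v\<close>
  vertices that can be coloured, one colouring is fixed by choice. It depends only on these edges, so the
  star of the next vertex is independent of it. The new vertex is tested against all non-full classes
  whether or not it is captured, which avoids conditioning on the event that it is not.
\<close>

lemma prob_no_sparse_coloring_le:
  assumes p: "0 < p" "p \<le> 1" and d: "2 * p * real s \<le> real d" and "0 < s"
  shows "measure_pmf.prob (random_subset p ([{1..v}]\<^bsup>2\<^esup>))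
     {E. card (uncaptured m v E) \<le> h * s \<and> (\<nexists>c. sparse_coloring (2 * h) s d E (uncaptured m v E) c)}
   \<le> real v * (1 - (1 - p\<^sup>2) ^ (s * d) / 2) ^ h"
proof (induction v)
  case 0
  have "sparse_coloring (2 * h) s d E {} c" if "E \<subseteq> {}" for E :: "nat set set" and c
    using that by (auto simp: sparse_coloring_def color_class_def)
  then have "measure_pmf.prob (random_subset p ([{1..0}]\<^bsup>2\<^esup>))
     {E. card (uncaptured m 0 E) \<le> h * s \<and> (\<nexists>c. sparse_coloring (2 * h) s d E (uncaptured m 0 E) c)}
     = measure_pmf.prob (random_subset p ([{1..0::nat}]\<^bsup>2\<^esup>)) {}"
    by (intro measure_pmf.finite_measure_eq_AE AE_pmfI)
      (auto simp: uncaptured_def nsets_empty_iff random_subset_empty)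
  then show ?case by simp
next
  case (Suc v)
  let ?V = "{1..v}"
  let ?x = "Suc v"
  let ?q = "(1 - (1 - p\<^sup>2) ^ (s * d) / 2) ^ h"
  let ?bad = "\<lambda>v E. card (uncaptured m v E) \<le> h * s \<and>
    (\<nexists>c. sparse_coloring (2 * h) s d E (uncaptured m v E) c)"
  let ?A = "random_subset p ([?V]\<^bsup>2\<^esup>)" and ?B = "random_subset p (star ?x ?V)"
  define c where "c = (\<lambda>A. SOME c. sparse_coloring (2 * h) s d A (uncaptured m v A) c)"
  define D where "D = (\<lambda>A. color_class (c A) (uncaptured m v A))"
  define J where "J = (\<lambda>A. {j. j < 2 * h \<and> card (D A j) < s})"
  \<comment> \<open>The new vertex is rejected by every non-full class of the colouring fixed for the past.\<close>
  let ?stuck = "\<lambda>A B. sparse_coloring (2 * h) s d A (uncaptured m v A) (c A) \<and>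
    h \<le> card (J A) \<and> (\<forall>j\<in>J A. blocked d A ?x (D A j) B)"
  have split: "[{1..Suc v}]\<^bsup>2\<^esup> = [?V]\<^bsup>2\<^esup> \<union> star ?x ?V" "[?V]\<^bsup>2\<^esup> \<inter> star ?x ?V = {}"
    by (simp_all add: nsets_2_insert nsets_2_disjoint_star atLeastAtMostSuc_conv)
  have fin: "finite ([?V]\<^bsup>2\<^esup>)" "finite (star ?x ?V)"
    by (simp_all add: finite_star finite_imp_finite_nsets)
  have stuck: "measure_pmf.prob (pair_pmf ?A ?B) {\<omega>. ?stuck (fst \<omega>) (snd \<omega>)} \<le> ?q"
  proof (rule prob_pair_pmf_le)
    fix A
    show "measure_pmf.prob ?B {B. ?stuck A B} \<le> ?q"
    proof (cases "sparse_coloring (2 * h) s d A (uncaptured m v A) (c A) \<and> h \<le> card (J A)")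
      case True
      then have eq: "{B. ?stuck A B} =
          {B. \<forall>j\<in>J A. blocked d A ?x (color_class (c A) (uncaptured m v A) j) B}"
        unfolding D_def by blast
      show ?thesis
        unfolding eq
      proof (rule prob_all_blocked_le[OF p d])
        show "finite (J A)" unfolding J_def by simp
        show "uncaptured m v A \<subseteq> ?V" by (auto simp: uncaptured_def)
      qed (use True in auto)
    next
      case False
      have "0 \<le> (1 - p\<^sup>2) ^ (s * d)" "(1 - p\<^sup>2) ^ (s * d) \<le> 1"
        using p by (auto intro!: power_le_one simp: power_le_one)
      then have "0 \<le> ?q"
        by (intro zero_le_power) linarith
      have eq: "{B. ?stuck A B} = {}" using False by blast
      show ?thesis
        unfolding eq using \<open>0 \<le> ?q\<close> by simp
    qed
  qed
  have "measure_pmf.prob (random_subset p ([{1..Suc v}]\<^bsup>2\<^esup>)) {E. ?bad (Suc v) E} =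
      measure_pmf.prob (pair_pmf ?A ?B) {\<omega>. ?bad (Suc v) (fst \<omega> \<union> snd \<omega>)}"
    unfolding split(1) random_subset_union[OF fin split(2)] by (simp add: vimage_def)
  also have "\<dots> \<le> measure_pmf.prob (pair_pmf ?A ?B) 
      ({\<omega>. ?bad v (fst \<omega>)} \<union> {\<omega>. ?stuck (fst \<omega>) (snd \<omega>)})"
  proof (intro measure_pmf.finite_measure_mono_AE AE_pmfI impI)
    fix \<omega> assume \<omega>: "\<omega> \<in> set_pmf (pair_pmf ?A ?B)" and bad: "\<omega> \<in> {\<omega>. ?bad (Suc v) (fst \<omega> \<union> snd \<omega>)}"
    obtain A B where [simp]: "\<omega> = (A, B)" by (cases \<omega>)
    have AB: "A \<subseteq> [?V]\<^bsup>2\<^esup>" "B \<subseteq> star ?x ?V"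
      using \<omega> set_random_subset[OF fin(1), of A p] set_random_subset[OF fin(2), of B p] by auto
    have "card (uncaptured m v A) \<le> card (uncaptured m (Suc v) (A \<union> B))"
      using uncaptured_Suc[OF AB, of m] by (intro card_mono) (auto simp: uncaptured_def)
    then have small: "card (uncaptured m v A) \<le> h * s"
      using bad by simp
    show "\<omega> \<in> {\<omega>. ?bad v (fst \<omega>)} \<union> {\<omega>. ?stuck (fst \<omega>) (snd \<omega>)}"
    proof (cases "\<exists>c. sparse_coloring (2 * h) s d A (uncaptured m v A) c")
      case True
      then have col: "sparse_coloring (2 * h) s d A (uncaptured m v A) (c A)"
        unfolding c_def by (rule someI_ex)
      then have "h \<le> card (J A)"
        unfolding J_def D_def using small \<open>0 < s\<close>
        by (intro sparse_coloring_many_open_classes) (auto simp: uncaptured_def)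
      moreover have "blocked d A ?x (D A j) B" if "j \<in> J A" for j
        using sparse_coloring_step[OF AB col, of j] that bad by (auto simp: J_def D_def)
      ultimately show ?thesis
        using col by simp
    qed (use small in simp)
  qed auto
  also have "\<dots> \<le> measure_pmf.prob (pair_pmf ?A ?B) {\<omega>. ?bad v (fst \<omega>)} +
      measure_pmf.prob (pair_pmf ?A ?B) {\<omega>. ?stuck (fst \<omega>) (snd \<omega>)}"
    by (intro measure_Un_le) auto
  also have "\<dots> \<le> measure_pmf.prob ?A {E. ?bad v E} + ?q"
    using prob_pair_pmf_indep[of ?A ?B "?bad v" "\<lambda>_. True"] stuck by (intro add_mono) simp_all
  finally show ?case
    using Suc.IH by (simp add: algebra_simps)
qed

section \<open>The clique colouring and its failure probability\<close>

lemma clique_insert: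
  assumes "clique V E K" "w \<in> V" "w \<notin> K" "star w K \<subseteq> E"
  shows "clique V E (insert w K)"
  using assms by (auto simp: clique_def nsets_2_insert)

text \<open>
  The deterministic part: capture colours come from \<open>{..<m}\<close>, greedy colours are shifted by \<open>m\<close>. A clique
  in a capture colour is extended by the capturing vertex. A clique in a greedy colour has at most two
  vertices, and an edge is extended by a common neighbour of its ends.
\<close>

lemma clique_chromatic_number_le:
  assumes E: "E \<subseteq> [{1..n}]\<^bsup>2\<^esup>" and col: "sparse_coloring k s d E (uncaptured m n E) c"
    and tri: "\<And>u v. u \<in> {1..n} \<Longrightarrow> v \<in> {1..n} \<Longrightarrow> u \<noteq> v \<Longrightarrow> \<exists>w\<in>{1..n} - {u, v}. star w {u, v} \<subseteq> E"
  shows "clique_chromatic_number {1..n} E \<le> m + k"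
proof -
  let ?W = "uncaptured m n E"
  define g where "g v = (SOME i. i \<in> {1..m} \<and> {i, v} \<in> E)" for v
  have g: "g v \<in> {1..m}" "{g v, v} \<in> E" if "v \<in> {1..n} - ?W" for v
  proof -
    have "\<exists>i. i \<in> {1..m} \<and> {i, v} \<in> E"
      using that by (auto simp: uncaptured_def)
    then have "g v \<in> {1..m} \<and> {g v, v} \<in> E"
      unfolding g_def by (rule someI_ex)
    then show "g v \<in> {1..m}" "{g v, v} \<in> E" by auto
  qed
  define f where "f v = (if v \<in> ?W then m + c v else g v - 1)" for v
  have "\<not> (\<forall>v\<in>K. f v = a)" if max: "maximal_clique {1..n} E K" and two: "2 \<le> card K" for K a
  proof
    assume mono: "\<forall>v\<in>K. f v = a"
    have K: "K \<subseteq> {1..n}" "clique {1..n} E K"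
      using max by (auto simp: maximal_clique_def clique_def)
    have no_ext: False if "w \<in> {1..n}" "w \<notin> K" "star w K \<subseteq> E" for w
      using max clique_insert[OF K(2) that] that(2) unfolding maximal_clique_def by blast
    obtain v0 where v0: "v0 \<in> K" using two by fastforce
    show False
    proof (cases "a < m")
      case True
      have edge: "{Suc a, v} \<in> E" if "v \<in> K" for v
      proof -
        have v: "v \<in> {1..n} - ?W" using mono that True K(1) by (force simp: f_def)
        then have "g v - 1 = a" using mono that by (force simp: f_def)
        then have "g v = Suc a" using g(1)[OF v] by (cases "g v") auto
        then show ?thesis using g(2)[OF v] by simp
      qed
      have mem: "Suc a \<in> {1..n} \<and> Suc a \<noteq> v" if "v \<in> K" for v
        using subsetD[OF E edge[OF that]] unfolding doubleton_in_nsets_2 by simp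
      have "star (Suc a) K \<subseteq> E"
        unfolding star_def using edge by (auto simp: insert_commute)
      moreover have "Suc a \<in> {1..n}" "Suc a \<notin> K"
        using mem[OF v0] mem[of "Suc a"] by blast+
      ultimately show False
        by (intro no_ext)
    next
      case False
      have "K \<subseteq> color_class c ?W (a - m)"
      proof
        fix v assume v: "v \<in> K"
        have "v \<in> ?W"
        proof (rule ccontr)
          assume "v \<notin> ?W"
          then have "g v - 1 = a" "v \<in> {1..n} - ?W"
            using K(1) mono v by (auto simp: f_def)
          then show False
            using g(1)[of v] False by auto
        qed
        then show "v \<in> color_class c ?W (a - m)"
          using mono v by (auto simp: f_def color_class_def)
      qed
      moreover have "[K]\<^bsup>2\<^esup> \<subseteq> E"
        using K(2) by (simp add: clique_def)
      ultimately have "card K = 2"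
        using col two unfolding sparse_coloring_def by (meson antisym)
      then obtain u v where uv: "K = {u, v}" "u \<noteq> v"
        by (auto simp: card_2_iff)
      then obtain w where "w \<in> {1..n} - {u, v}" "star w {u, v} \<subseteq> E"
        using tri[of u v] K(1) by blast
      then show False
        using no_ext[of w] uv(1) by simp
    qed
  qed
  moreover have "f ` {1..n} \<subseteq> {..<m + k}"
  proof
    fix a assume "a \<in> f ` {1..n}"
    then obtain v where v: "v \<in> {1..n}" "a = f v" by auto
    then show "a \<in> {..<m + k}"
      using g(1)[of v] col by (fastforce simp: f_def sparse_coloring_def)
  qed
  ultimately have "clique_coloring {1..n} E (m + k) f"
    unfolding clique_coloring_def by blast
  then show ?thesis
    unfolding clique_chromatic_number_def by (intro Least_le) blast
qed

lemma prob_many_uncaptured_le: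
  assumes p: "0 < p" "p < 1" and "m < N"
  shows "measure_pmf.prob (random_subset p ([{1..n}]\<^bsup>2\<^esup>)) {E. N < card (uncaptured m n E)}
    \<le> real n * (1 - p) ^ m / (real N - real m)"
proof -
  let ?R = "random_subset p ([{1..n}]\<^bsup>2\<^esup>)"
  let ?Q = "\<lambda>v E. E \<inter> star v {1..m} = {}"
  have fin: "finite ([{1..n}]\<^bsup>2\<^esup>)" by (simp add: finite_imp_finite_nsets)
  have Q: "measure_pmf.prob ?R {E. ?Q v E} = (1 - p) ^ m" if v: "v \<in> {Suc m..n}" for v
  proof -
    have sub: "star v {1..m} \<subseteq> [{1..n}]\<^bsup>2\<^esup>"
    proof
      fix e assume "e \<in> star v {1..m}"
      then obtain i where "e = {i, v}" "i \<in> {1..m}" by (auto simp: star_def)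
      then show "e \<in> [{1..n}]\<^bsup>2\<^esup>"
        using v by simp
    qed
    have "card (star v {1..m}) = m"
      using v card_image[OF inj_on_star_edge[of v "{1..m}"]] by (simp add: star_def)
    then show ?thesis
      using prob_random_subset_restrict[OF fin sub, of p "\<lambda>E. E = {}"]
        prob_random_subset_eq_empty[of "star v {1..m}" p] p by (simp add: finite_star)
  qed
  have "measure_pmf.prob ?R {E. N < card (uncaptured m n E)} \<le>
      measure_pmf.prob ?R {E. real N - real m \<le> real (card {v\<in>{Suc m..n}. ?Q v E})}"
  proof (intro measure_pmf.finite_measure_mono subsetI)
    fix E assume "E \<in> {E. N < card (uncaptured m n E)}"
    have "uncaptured m n E \<subseteq> {1..m} \<union> {v\<in>{Suc m..n}. ?Q v E}"
      by (auto simp: uncaptured_def star_def)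
    then have "card (uncaptured m n E) \<le> card {1..m} + card {v\<in>{Suc m..n}. ?Q v E}"
      by (intro order.trans[OF card_mono card_Un_le]) auto
    then show "E \<in> {E. real N - real m \<le> real (card {v\<in>{Suc m..n}. ?Q v E})}"
      using \<open>E \<in> _\<close> by simp
  qed simp
  also have "\<dots> \<le> (\<Sum>v\<in>{Suc m..n}. measure_pmf.prob ?R {E. ?Q v E}) / (real N - real m)"
    using \<open>m < N\<close> by (intro prob_card_ge_le) auto
  also have "\<dots> = real (n - m) * (1 - p) ^ m / (real N - real m)"
    using Q by simp
  also have "\<dots> \<le> real n * (1 - p) ^ m / (real N - real m)"
    using p \<open>m < N\<close> by (intro divide_right_mono mult_right_mono) auto
  finally show ?thesis .
qed

lemma prob_no_common_neighbour_le:
  assumes p: "0 < p" "p < 1" and uv: "u \<in> {1..n}" "v \<in> {1..n}" "u \<noteq> v"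
  shows "measure_pmf.prob (random_subset p ([{1..n}]\<^bsup>2\<^esup>))
     {E. \<forall>w\<in>{1..n} - {u, v}. \<not> star w {u, v} \<subseteq> E} \<le> (1 - p\<^sup>2) ^ (n - 2)"
proof -
  let ?R = "random_subset p ([{1..n}]\<^bsup>2\<^esup>)"
  let ?I = "{1..n} - {u, v}"
  have "measure_pmf.prob ?R {E. \<forall>w\<in>?I. \<not> star w {u, v} \<subseteq> E \<inter> star w {u, v}} \<le> (1 - p\<^sup>2) ^ card ?I"
  proof (rule prob_random_subset_indep_le)
    show "disjoint_family_on (\<lambda>w. star w {u, v}) ?I"
      using uv by (auto simp: disjoint_family_on_def star_def doubleton_eq_iff)
    show "(\<Union>w\<in>?I. star w {u, v}) \<subseteq> [{1..n}]\<^bsup>2\<^esup>"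
      using uv unfolding star_def by auto
    fix w assume w: "w \<in> ?I"
    have "measure_pmf.prob (random_subset p (star w {u, v})) {E. star w {u, v} \<subseteq> E} = p\<^sup>2"
      using prob_random_subset_contains[of "star w {u, v}" p] p w uv
        card_image[OF inj_on_star_edge[of w "{u, v}"]]
      by (simp add: finite_star) (simp add: star_def power2_eq_square)
    then show "measure_pmf.prob (random_subset p (star w {u, v})) {E. \<not> star w {u, v} \<subseteq> E} \<le> 1 - p\<^sup>2"
      using measure_pmf.prob_compl[of "{E. star w {u, v} \<subseteq> E}" "random_subset p (star w {u, v})"]
      by (simp add: Compl_eq_Diff_UNIV[symmetric] Collect_neg_eq[symmetric])
  qed (use p in \<open>auto simp: finite_star finite_imp_finite_nsets power_le_one\<close>)
  moreover have "card ?I = n - 2"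
    using uv by (subst card_Diff_subset) auto
  ultimately show ?thesis
    by simp
qed

text \<open>
  The three error terms bound the probabilities that too many vertices are uncaptured, that the greedy
  procedure gets stuck, and that some pair of vertices has no common neighbour.
\<close>

lemma prob_clique_chromatic_number_le_ge:
  assumes p: "0 < p" "p < 1" and d: "2 * p * real s \<le> real d" and "m < h * s"
  shows "1 - (real n * (1 - p) ^ m / (real (h * s) - real m) +
      real n * (1 - (1 - p\<^sup>2) ^ (s * d) / 2) ^ h + (real n)\<^sup>2 * (1 - p\<^sup>2) ^ (n - 2))
    \<le> measure_pmf.prob (Gnp n p) {E. clique_chromatic_number {1..n} E \<le> m + 2 * h}"
proof -
  let ?R = "random_subset p ([{1..n}]\<^bsup>2\<^esup>)"
  let ?I = "{(u, v). u \<in> {1..n} \<and> v \<in> {1..n} \<and> u \<noteq> v}"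
  let ?U = "{E. h * s < card (uncaptured m n E)}"
  let ?G = "{E. card (uncaptured m n E) \<le> h * s \<and>
    (\<nexists>c. sparse_coloring (2 * h) s d E (uncaptured m n E) c)}"
  let ?N = "\<lambda>(u, v). {E. \<forall>w\<in>{1..n} - {u, v}. \<not> star w {u, v} \<subseteq> E}"
  let ?good = "{E. clique_chromatic_number {1..n} E \<le> m + 2 * h}"
  have finI: "finite ?I"
    by (rule finite_subset[of _ "{1..n} \<times> {1..n}"]) auto
  have "card ?I \<le> card ({1..n} \<times> {1..n})"
    by (intro card_mono) auto
  then have cardI: "real (card ?I) \<le> (real n)\<^sup>2"
    by (simp add: power2_eq_square flip: of_nat_mult)
  have "measure_pmf.prob ?R (- ?good) \<le> measure_pmf.prob ?R (?U \<union> ?G \<union> (\<Union>e\<in>?I. ?N e))"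
  proof (intro measure_pmf.finite_measure_mono_AE AE_pmfI impI)
    fix E assume "E \<in> set_pmf ?R" and bad: "E \<in> - ?good"
    then have E: "E \<subseteq> [{1..n}]\<^bsup>2\<^esup>"
      using set_random_subset[of "[{1..n}]\<^bsup>2\<^esup>" E p] by (simp add: finite_imp_finite_nsets)
    show "E \<in> ?U \<union> ?G \<union> (\<Union>e\<in>?I. ?N e)"
    proof (rule ccontr)
      assume no: "E \<notin> ?U \<union> ?G \<union> (\<Union>e\<in>?I. ?N e)"
      then obtain c where "sparse_coloring (2 * h) s d E (uncaptured m n E) c"
        by (auto simp: not_less)
      moreover have "\<exists>w\<in>{1..n} - {u, v}. star w {u, v} \<subseteq> E"
        if "u \<in> {1..n}" "v \<in> {1..n}" "u \<noteq> v" for u v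
        using no that by blast
      ultimately show False
        using clique_chromatic_number_le[OF E] bad by simp
    qed
  qed simp
  also have "\<dots> \<le> measure_pmf.prob ?R ?U + measure_pmf.prob ?R ?G + measure_pmf.prob ?R (\<Union>e\<in>?I. ?N e)"
    by (intro order.trans[OF measure_Un_le] add_right_mono measure_Un_le) auto
  also have "\<dots> \<le> real n * (1 - p) ^ m / (real (h * s) - real m) +
      real n * (1 - (1 - p\<^sup>2) ^ (s * d) / 2) ^ h + (real n)\<^sup>2 * (1 - p\<^sup>2) ^ (n - 2)"
  proof (intro add_mono)
    show "measure_pmf.prob ?R ?U \<le> real n * (1 - p) ^ m / (real (h * s) - real m)"
      using prob_many_uncaptured_le[OF p \<open>m < h * s\<close>] .
    show "measure_pmf.prob ?R ?G \<le> real n * (1 - (1 - p\<^sup>2) ^ (s * d) / 2) ^ h"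
      using p d \<open>m < h * s\<close> by (intro prob_no_sparse_coloring_le) (auto intro: Nat.gr0I)
    have "measure_pmf.prob ?R (\<Union>e\<in>?I. ?N e) \<le> (\<Sum>e\<in>?I. measure_pmf.prob ?R (?N e))"
      using finI by (intro measure_UNION_le) auto
    also have "\<dots> \<le> (\<Sum>e\<in>?I. (1 - p\<^sup>2) ^ (n - 2))"
    proof (rule sum_mono)
      fix e assume "e \<in> ?I"
      then show "measure_pmf.prob ?R (?N e) \<le> (1 - p\<^sup>2) ^ (n - 2)"
        using prob_no_common_neighbour_le[OF p] by (cases e) auto
    qed
    also have "\<dots> \<le> (real n)\<^sup>2 * (1 - p\<^sup>2) ^ (n - 2)"
      using cardI p by (simp add: mult_right_mono power_le_one)
    finally show "measure_pmf.prob ?R (\<Union>e\<in>?I. ?N e) \<le> (real n)\<^sup>2 * (1 - p\<^sup>2) ^ (n - 2)" .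
  qed
  finally show ?thesis
    using measure_pmf.prob_compl[of ?good ?R]
    by (simp add: Gnp_eq_random_subset Compl_eq_Diff_UNIV)
qed

section \<open>Choice of the parameters\<close>

lemma one_minus_ge_exp:
  fixes x :: real
  assumes "0 \<le> x" "x \<le> 1 / 2"
  shows "exp (- (2 * x)) \<le> 1 - x"
proof -
  have "- x - 2 * x\<^sup>2 \<le> ln (1 - x)"
    using assms by (rule ln_one_minus_pos_lower_bound)
  moreover have "x * x \<le> x * (1 / 2)"
    using assms by (intro mult_left_mono) auto
  ultimately have "- (2 * x) \<le> ln (1 - x)"
    by (simp add: power2_eq_square)
  then show ?thesis
    using assms by (simp add: ln_ge_iff)
qed

lemma one_minus_power_le_exp:
  fixes x :: real
  assumes "x \<le> 1"
  shows "(1 - x) ^ k \<le> exp (- (x * real k))"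
proof -
  have "(1 - x) ^ k \<le> exp (- x) ^ k"
    using assms exp_ge_add_one_self[of "- x"] by (intro power_mono) auto
  then show ?thesis
    by (simp flip: exp_of_nat_mult add: mult.commute)
qed

text \<open>
  In terms of \<open>a = p powr (- 1/2)\<close> and \<open>b = L powr (1/4)\<close> the scales become monomials: \<open>m\<close> is of order
  \<open>\<epsilon> L a\<^sup>2\<close>, classes have up to \<open>s\<close> vertices with \<open>s\<close> of order \<open>a\<^sup>3 b\<^sup>2\<close>, and \<open>h\<close> is of order \<open>a\<^sup>2 / b\<close>. The
  classes can hold \<open>h s\<close> vertices, of order \<open>a\<^sup>5 b\<close>, whereas at most \<open>a\<^sup>5\<close> vertices beyond \<open>m\<close> are expected
  to stay uncaptured. The expected number of triangles that a new vertex would close in a class is at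
  most \<open>p\<^sup>2 s d \<le> 3 L / 100\<close>; the constant is small enough that the resulting factor \<open>N powr (- 3/50)\<close> does not
  outweigh the \<open>N powr (1/9)\<close> classes.
\<close>

lemma parameter_choice:
  fixes N L p \<epsilon> b :: real
  assumes N: "1 < N" and p: "p = N powr (- 2 / 5 + \<epsilon>)"
    and lower: "2 * N powr (- 2 / 5) \<le> p" and upper: "p \<le> N powr (- 1 / 9)"
    and L: "L = ln N" "1 \<le> L" and b: "b = L powr (1 / 4)"
    and large: "N powr (- 1 / 9) \<le> 1 / 2" "20 \<le> N powr (1 / 18) * b\<^sup>2" "5 / 2 * L + 1 \<le> N powr (1 / 6) * b"
  obtains m h s d :: nat where
    "2 * p * real s \<le> real d" "m < h * s"
    "real (m + 2 * h) \<le> (5 / 2 + (3 * N powr (- 1 / 9) + 80 / b) / ln 2) * \<epsilon> * L / p"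
    "N * (1 - p) ^ m / (real (h * s) - real m) \<le> 1 / b"
    "(1 - (1 - p\<^sup>2) ^ (s * d) / 2) ^ h \<le> exp (- (20 * N powr (1 / 9 - 3 / 50) / b))"
proof -
  define a where "a = p powr (- 1 / 2)"
  have p0: "0 < p" using p N by simp
  have p_half: "p \<le> 1 / 2" using upper large(1) by simp
  have b1: "1 \<le> b" unfolding b using L(2) by (simp add: ge_one_powr_ge_zero)
  have b4: "b ^ 4 = L"
    unfolding b using L(2) by (simp add: powr_power)
  have a0: "0 < a" unfolding a_def using p0 by simp
  have ap: "a\<^sup>2 * p = 1"
  proof -
    have "a\<^sup>2 = p powr - 1"
      unfolding a_def using p0 by (simp add: powr_power)
    then show ?thesis
      using p0 by (simp add: powr_neg_one)
  qed
  then have p_eq: "p = 1 / a\<^sup>2"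
    using a0 by (simp add: field_simps)
  have a_ge: "N powr (1 / 18) \<le> a"
  proof -
    have "(N powr (- 1 / 9)) powr (- 1 / 2) \<le> p powr (- 1 / 2)"
      using upper p0 by (intro powr_mono2') auto
    then show ?thesis by (simp add: a_def powr_powr)
  qed
  have a2_ge: "N powr (1 / 9) \<le> a\<^sup>2"
  proof -
    have "N powr (1 / 9) = (N powr (1 / 18))\<^sup>2"
      using N by (simp add: powr_power)
    also have "\<dots> \<le> a\<^sup>2"
      using a_ge by (intro power_mono) auto
    finally show ?thesis .
  qed
  have a3_ge: "N powr (1 / 6) \<le> a ^ 3"
  proof -
    have "N powr (1 / 6) = (N powr (1 / 18)) ^ 3"
      using N by (simp add: powr_power)
    also have "\<dots> \<le> a ^ 3"
      using a_ge by (intro power_mono) auto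
    finally show ?thesis .
  qed
  have a5: "a ^ 5 = p powr (- 5 / 2)"
    unfolding a_def using p0 by (simp add: powr_power)
  have a1: "1 \<le> a"
    using a_ge ge_one_powr_ge_zero[of N "1 / 18"] N by simp
  have ab: "20 \<le> a * b\<^sup>2"
    using large(2) mult_right_mono[OF a_ge, of "b\<^sup>2"] by simp
  have \<epsilon>: "ln 2 \<le> \<epsilon> * L" "\<epsilon> \<le> 1"
  proof -
    have "2 \<le> N powr \<epsilon>"
      using lower N unfolding p powr_add by (simp add: mult.commute)
    then have "ln 2 \<le> ln (N powr \<epsilon>)"
      by (subst ln_le_cancel_iff) auto
    then show "ln 2 \<le> \<epsilon> * L"
      using N by (simp add: ln_powr L(1))
    have "- 2 / 5 + \<epsilon> \<le> - 1 / 9"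
      using upper N unfolding p by simp
    then show "\<epsilon> \<le> 1" by simp
  qed
  \<comment> \<open>Subtracting the floors and ceilings costs additive constants, which the hypotheses on large \<open>N\<close> absorb.\<close>
  define m where "m = nat \<lceil>5 / 2 * \<epsilon> * L / p\<rceil>"
  define s where "s = nat \<lfloor>a ^ 3 * b\<^sup>2 / 10\<rfloor>"
  define h where "h = nat \<lceil>40 * a\<^sup>2 / b\<rceil>"
  define d where "d = nat \<lceil>2 * p * real s\<rceil>"
  have \<epsilon>L: "0 < \<epsilon> * L" using \<epsilon>(1) ln_gt_zero[of "2::real"] by linarith
  have "0 \<le> 5 / 2 * \<epsilon> * L / p" using \<epsilon>L p0 by (simp add: mult.assoc)
  then have m: "5 / 2 * \<epsilon> * L / p \<le> real m" "real m \<le> 5 / 2 * \<epsilon> * L / p + 1"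
    unfolding m_def by linarith+
  have "0 \<le> 40 * a\<^sup>2 / b" using b1 by simp
  then have h: "40 * a\<^sup>2 / b \<le> real h" "real h \<le> 40 * a\<^sup>2 / b + 1"
    unfolding h_def by linarith+
  have a3b: "20 \<le> a ^ 3 * b\<^sup>2"
  proof -
    have "1 * (a * b\<^sup>2) \<le> a\<^sup>2 * (a * b\<^sup>2)"
      using a1 ab by (intro mult_right_mono) auto
    then show ?thesis using ab by (simp add: power2_eq_square power3_eq_cube)
  qed
  then have s: "a ^ 3 * b\<^sup>2 / 20 \<le> real s" "real s \<le> a ^ 3 * b\<^sup>2 / 10"
    unfolding s_def by linarith+
  have ps: "1 \<le> p * real s"
  proof -
    have "1 \<le> a * b\<^sup>2 / 20" using ab by simp
    also have "\<dots> = p * (a ^ 3 * b\<^sup>2 / 20)"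
      using a0 by (simp add: p_eq field_simps power2_eq_square power3_eq_cube)
    also have "\<dots> \<le> p * real s" using s(1) p0 by (intro mult_left_mono) auto
    finally show ?thesis .
  qed
  have d: "2 * p * real s \<le> real d" "real d \<le> 3 * (p * real s)"
    using ps unfolding d_def by linarith+
  have hs: "2 * (a ^ 5 * b) \<le> real (h * s)"
  proof -
    have "2 * (a ^ 5 * b) = (40 * a\<^sup>2 / b) * (a ^ 3 * b\<^sup>2 / 20)"
      using b1 by (simp add: field_simps power2_eq_square eval_nat_numeral)
    also have "\<dots> \<le> real h * real s"
      using h(1) s(1) a0 b1 by (intro mult_mono) auto
    finally show ?thesis by simp
  qed
  have m_le: "real m \<le> a ^ 5 * b"
  proof -
    have "5 / 2 * \<epsilon> * L / p \<le> 5 / 2 * L * a\<^sup>2"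
      using \<epsilon>(2) L(2) a0 by (simp add: p_eq mult_right_mono)
    moreover have "1 \<le> a\<^sup>2" using a1 by simp
    ultimately have "real m \<le> 5 / 2 * L * a\<^sup>2 + a\<^sup>2"
      using m(2) by linarith
    also have "\<dots> = (5 / 2 * L + 1) * a\<^sup>2"
      by (simp add: algebra_simps)
    also have "\<dots> \<le> (a ^ 3 * b) * a\<^sup>2"
    proof (rule mult_right_mono)
      have "N powr (1 / 6) * b \<le> a ^ 3 * b"
        using a3_ge b1 by (intro mult_right_mono) auto
      then show "5 / 2 * L + 1 \<le> a ^ 3 * b"
        using large(3) by linarith
    qed simp
    also have "\<dots> = a ^ 5 * b"
      by (simp add: eval_nat_numeral)
    finally show ?thesis .
  qed
  have a5b: "0 < a ^ 5 * b" using a0 b1 by simp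
  have gap: "a ^ 5 * b \<le> real (h * s) - real m"
    using hs m_le by simp
  show ?thesis
  proof (rule that)
    show "2 * p * real s \<le> real d" by (rule d(1))
    show "m < h * s" using gap a5b by linarith
    have "real (m + 2 * h) \<le> 5 / 2 * \<epsilon> * L / p + (3 + 80 * a\<^sup>2 / b)"
      using m(2) h(2) by simp
    \<comment> \<open>The extra colours are compared with the main term through \<open>1 \<le> \<epsilon> L / ln 2\<close>.\<close>
    also have "3 + 80 * a\<^sup>2 / b = (3 * p + 80 / b) / p"
      using p0 a0 by (simp add: p_eq field_simps)
    also have "\<dots> \<le> (3 * N powr (- 1 / 9) + 80 / b) * 1 / p"
      using upper p0 by (intro divide_right_mono) auto
    also have "\<dots> \<le> (3 * N powr (- 1 / 9) + 80 / b) * (\<epsilon> * L / ln 2) / p"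
      using p0 \<epsilon>(1) b1 by (intro divide_right_mono mult_left_mono) (auto simp: field_simps)
    finally show "real (m + 2 * h) \<le> (5 / 2 + (3 * N powr (- 1 / 9) + 80 / b) / ln 2) * \<epsilon> * L / p"
      by (simp add: algebra_simps add_divide_distrib)
    have "(1 - p) ^ m \<le> exp (- (p * real m))"
      using p_half by (intro one_minus_power_le_exp) auto
    also have "\<dots> \<le> exp (- (5 / 2 * \<epsilon> * L))"
      using m(1) p0 by (simp add: field_simps)
    also have "\<dots> = N powr (- (5 / 2) * \<epsilon>)"
      using N by (simp add: powr_def L(1))
    finally have "N * (1 - p) ^ m \<le> N powr 1 * N powr (- (5 / 2) * \<epsilon>)"
      using N by simp
    also have "\<dots> = N powr ((- 2 / 5 + \<epsilon>) * (- 5 / 2))"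
      unfolding powr_add[symmetric] by (simp add: algebra_simps)
    also have "\<dots> = a ^ 5"
      unfolding a5 p powr_powr ..
    finally have "N * (1 - p) ^ m / (real (h * s) - real m) \<le> a ^ 5 / (a ^ 5 * b)"
      using gap a5b a0 p_half N by (intro frac_le) auto
    then show "N * (1 - p) ^ m / (real (h * s) - real m) \<le> 1 / b"
      using a0 by simp
    have psd: "p\<^sup>2 * real (s * d) \<le> 3 / 100 * L"
    proof -
      have "p\<^sup>2 * real (s * d) \<le> p\<^sup>2 * (real s * (3 * (p * real s)))"
        using d(2) by (auto intro!: mult_left_mono)
      also have "\<dots> = 3 * p ^ 3 * (real s)\<^sup>2"
        by (simp add: power2_eq_square power3_eq_cube)
      also have "\<dots> \<le> 3 * p ^ 3 * (a ^ 3 * b\<^sup>2 / 10)\<^sup>2"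
        using s(2) p0 by (intro mult_left_mono power_mono) auto
      also have "\<dots> = 3 / 100 * (a\<^sup>2 * p) ^ 3 * b ^ 4"
        by (simp add: power_mult_distrib power_divide flip: power_mult)
      finally show ?thesis by (simp add: ap b4)
    qed
    have p2: "p\<^sup>2 \<le> 1 / 2"
      using power_mono[OF p_half, of 2] p0 by (simp add: power2_eq_square)
    have x_ge: "N powr (- 3 / 50) \<le> (1 - p\<^sup>2) ^ (s * d)"
    proof -
      have "N powr (- 3 / 50) = exp (- (2 * (3 / 100 * L)))"
        using N by (simp add: powr_def L(1))
      also have "\<dots> \<le> exp (- (2 * (p\<^sup>2 * real (s * d))))"
        using psd by simp
      also have "\<dots> = exp (- (2 * p\<^sup>2)) ^ (s * d)"
        unfolding exp_of_nat_mult[symmetric] by (simp add: algebra_simps)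
      also have "\<dots> \<le> (1 - p\<^sup>2) ^ (s * d)"
        using one_minus_ge_exp[OF zero_le_power2 p2] by (intro power_mono) auto
      finally show ?thesis .
    qed
    let ?x = "(1 - p\<^sup>2) ^ (s * d) / 2"
    have "?x \<le> 1"
      using p2 power_le_one[of "1 - p\<^sup>2" "s * d"] by simp
    then have "(1 - ?x) ^ h \<le> exp (- (?x * real h))"
      by (rule one_minus_power_le_exp)
    also have "\<dots> \<le> exp (- (20 * N powr (1 / 9 - 3 / 50) / b))"
    proof -
      have "20 * N powr (1 / 9 - 3 / 50) / b = N powr (- 3 / 50) / 2 * (40 * N powr (1 / 9) / b)"
      proof -
        have split: "N powr (1 / 9 - 3 / 50) = N powr (- 3 / 50) * N powr (1 / 9)"
          by (simp flip: powr_add)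
        show ?thesis
          unfolding split by simp
      qed
      also have "\<dots> \<le> ?x * (40 * a\<^sup>2 / b)"
        using x_ge a2_ge b1 p2 by (intro mult_mono divide_right_mono) auto
      also have "\<dots> \<le> ?x * real h"
        using h(1) p2 by (intro mult_left_mono) auto
      finally show ?thesis by simp
    qed
    finally show "(1 - ?x) ^ h \<le> exp (- (20 * N powr (1 / 9 - 3 / 50) / b))" .
  qed
qed

theorem lemma5p3:
  fixes p \<epsilon> :: "nat \<Rightarrow> real"
  assumes "\<forall>\<^sub>F n in sequentially. 0 < p n \<and> p n < 1"
    and "\<forall>\<^sub>F n in sequentially. p n = real n powr (- 2 / 5 + \<epsilon> n)"
    and "\<forall>\<^sub>F n in sequentially. 2 * real n powr (- 2 / 5) \<le> p n \<and> p n \<le> real n powr (- 1 / 9)"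
  shows "\<exists>\<delta> :: nat \<Rightarrow> real. \<delta> \<longlonglongrightarrow> 0 \<and>
    (\<lambda>n. measure_pmf.prob (Gnp n (p n))
       {E. real (clique_chromatic_number {1..n} E) \<le> (5 / 2 + \<delta> n) * \<epsilon> n * ln (real n) / p n})
    \<longlonglongrightarrow> 1"
proof (intro exI conjI)
  define b where "b n = ln (real n) powr (1 / 4)" for n :: nat
  define \<delta> where "\<delta> n = (3 * real n powr (- 1 / 9) + 80 / b n) / ln 2" for n
  define err where "err n = 1 / b n + real n * exp (- (20 * real n powr (1 / 9 - 3 / 50) / b n)) +
    (real n)\<^sup>2 * exp (- (4 * real n powr (- 4 / 5) * (real n - 2)))" for n
  show "\<delta> \<longlonglongrightarrow> 0"
    unfolding \<delta>_def b_def by real_asymp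
  let ?prob = "\<lambda>n. measure_pmf.prob (Gnp n (p n))
    {E. real (clique_chromatic_number {1..n} E) \<le> (5 / 2 + \<delta> n) * \<epsilon> n * ln (real n) / p n}"
  have large: "\<forall>\<^sub>F n in sequentially. real n powr (- 1 / 9) \<le> 1 / 2"
    "\<forall>\<^sub>F n in sequentially. 20 \<le> real n powr (1 / 18) * (b n)\<^sup>2"
    "\<forall>\<^sub>F n in sequentially. 5 / 2 * ln (real n) + 1 \<le> real n powr (1 / 6) * b n"
    "\<forall>\<^sub>F n in sequentially. 1 \<le> ln (real n)"
    unfolding b_def by real_asymp+
  have "\<forall>\<^sub>F n in sequentially. 1 - err n \<le> ?prob n"
    using assms large eventually_ge_at_top[of 2]
  proof eventually_elim
    case (elim n)
    then have n: "1 < real n" and p: "0 < p n" "p n < 1" by auto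
    obtain m h s d :: nat where
      d: "2 * p n * real s \<le> real d" and "m < h * s" and
      colors: "real (m + 2 * h) \<le>
        (5 / 2 + (3 * real n powr (- 1 / 9) + 80 / b n) / ln 2) * \<epsilon> n * ln (real n) / p n" and
      err1: "real n * (1 - p n) ^ m / (real (h * s) - real m) \<le> 1 / b n" and
      err2: "(1 - (1 - (p n)\<^sup>2) ^ (s * d) / 2) ^ h \<le> exp (- (20 * real n powr (1 / 9 - 3 / 50) / b n))"
      using elim n
      by (elim conjE)
        (rule parameter_choice[of "real n" "p n" "\<epsilon> n" "ln (real n)" "b n"]; simp add: b_def)
    have err3: "(1 - (p n)\<^sup>2) ^ (n - 2) \<le> exp (- (4 * real n powr (- 4 / 5) * (real n - 2)))"
    proof -
      have "(1 - (p n)\<^sup>2) ^ (n - 2) \<le> exp (- ((p n)\<^sup>2 * real (n - 2)))"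
        using p by (intro one_minus_power_le_exp) (simp add: power_le_one)
      also have "(2 * real n powr (- 2 / 5))\<^sup>2 \<le> (p n)\<^sup>2"
        using elim by (intro power_mono) auto
      then have "4 * real n powr (- 4 / 5) \<le> (p n)\<^sup>2"
        using n by (simp add: power_mult_distrib powr_power)
      then have "exp (- ((p n)\<^sup>2 * real (n - 2))) \<le> exp (- (4 * real n powr (- 4 / 5) * real (n - 2)))"
        by (simp add: mult_right_mono)
      finally show ?thesis
        using elim by (simp add: of_nat_diff)
    qed
    have "1 - err n \<le> 1 - (real n * (1 - p n) ^ m / (real (h * s) - real m) +
      real n * (1 - (1 - (p n)\<^sup>2) ^ (s * d) / 2) ^ h + (real n)\<^sup>2 * (1 - (p n)\<^sup>2) ^ (n - 2))"
      unfolding err_def using err1 err2 err3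
      by (intro diff_left_mono add_mono mult_left_mono) auto
    also have "\<dots> \<le> measure_pmf.prob (Gnp n (p n)) {E. clique_chromatic_number {1..n} E \<le> m + 2 * h}"
      by (rule prob_clique_chromatic_number_le_ge[OF p d \<open>m < h * s\<close>])
    also have "\<dots> \<le> ?prob n"
    proof (intro measure_pmf.finite_measure_mono subsetI)
      fix E assume "E \<in> {E. clique_chromatic_number {1..n} E \<le> m + 2 * h}"
      then have "real (clique_chromatic_number {1..n} E) \<le> real (m + 2 * h)"
        by (simp del: of_nat_add)
      then show "E \<in> {E. real (clique_chromatic_number {1..n} E) \<le> (5 / 2 + \<delta> n) * \<epsilon> n * ln (real n) / p n}"
        using colors unfolding \<delta>_def by simp
    qed simp
    finally show ?case .
  qed
  moreover have "(\<lambda>n. 1 - err n) \<longlonglongrightarrow> 1"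
    unfolding err_def b_def by real_asymp
  moreover have "\<forall>\<^sub>F n in sequentially. ?prob n \<le> 1"
    by simp
  ultimately show "?prob \<longlonglongrightarrow> 1"
    using tendsto_sandwich[of "\<lambda>n. 1 - err n" ?prob sequentially "\<lambda>_. 1" 1] by auto
qed

end
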